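(* Let $\mathcal B$ be a basis of $\mathbb X$ that is $\mathbf K_u$-$\mathbf n$-unconditional for constant coefficients. Then: (i) If $\mathbf n$ has $l$-bounded additive gaps, then $\mathcal B$ is $\mathbf C$-unconditional for constant coefficients with $\mathbf C\le \max\{(n_1-1)\alpha_1\alpha_2,\ \mathbf K_u+\mathbf K_u l\alpha_1\alpha_2+l\alpha_1\alpha_2\}$. (ii) If $\mathbf n$ has $l$-bounded quotient gaps and $\mathcal B$ is Schauder with basis constant $\mathbf K$, then $\mathcal B$ is $\mathbf C$-unconditional for constant coefficients with $\mathbf C\le\max\{(n_1-1)\alpha_1\alpha_2,\ (2l-1)\mathbf K_u\mathbf K\}$.
   Context: $\mathbb X$ is a separable infinite-dimensional Banach space over $\mathbb F=\mathbb R$ or $\mathbb C$, with dual $\mathbb X^*$. A basis of $\mathbb X$ is a sequence $\mathcal B=(\mathbf e_i)_{i\in\mathbb N}\subset\mathbb X$ with closed linear span $\mathbb X$, having a (unique) sequence of biorthogonal functionals $(\mathbf e_i^* )_{i\in\mathbb N}\subset\mathbb X^*$ ($\mathbf e_k^*(\mathbf e_i)=\delta_{k,i}$), with $0<\inf_i\min\{\|\mathbf e_i\|,\|\mathbf e_i^*\|\}\le\sup_i\max\{\|\mathbf e_i\|,\|\mathbf e_i^*\|\}<\infty$. Put $\alpha_1=\sup_i\|\mathbf e_i\|$, $\alpha_2=\sup_i\|\mathbf e_i^*\|$. The basis is Schauder if it is total ($\mathbf e_i^*(x)=0$ for all $i$ implies $x=0$) and there is $\mathbf C>0$ with $\|\sum_{i=1}^m\mathbf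 e_i^*(x)\mathbf e_i\|\le\mathbf C\|x\|$ for all $x\in\mathbb X$, $m\in\mathbb N$; the least such $\mathbf C$ is its basis constant. $\mathbf n=(n_k)_{k\in\mathbb N}$ is a strictly increasing sequence of positive integers, also regarded as a subset of $\mathbb N$ ($\mathbf n=\mathbb N$ is allowed). For an integer $l\ge2$, $\mathbf n$ has $l$-bounded additive gaps if $n_{k+1}-n_k\le l$ for all $k$, and $l$-bounded quotient gaps if $n_{k+1}/n_k\le l$ for all $k$. For a finite $A\subset\mathbb N$, $\Psi_A$ is the set of families $\varepsilon=(\varepsilon_n)_{n\in A}\subset\mathbb F$ with $|\varepsilon_n|=1$, and $\mathbf 1_{\varepsilon A}=\sum_{n\in A}\varepsilon_n\mathbf e_n$. $\mathcal B$ is $\mathbf n$-unconditional for constant coefficients if there is $\mathbf C>0$ with $\|\mathbf 1_{\varepsilon A}\|\le\mathbf C\|\mathbf 1_{\varepsilon'A}\|$ for all $A\subset\mathbb N$ with $|A|\in\mathbf n$ and all $\varepsilon,\varepsilon'\in\Psi_A$; it is called $\mathbf K_u$-$\mathbf n$-unconditional for constant coefficients when $\mathbf K_u$ is the smallest such constant. For $\mathbf n=\mathbb N$ one says $\mathbf K_u$-unconditional for constant coefficients. *)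

theory Defs
  imports "HOL-Analysis.Analysis"
begin

section \<open>The scalar field and Banach spaces over it\<close>

definition isometric_field_isomorphism ::
    "('f::real_normed_field \<Rightarrow> 'g::real_normed_field) \<Rightarrow> bool" where
  "isometric_field_isomorphism \<phi> \<longleftrightarrow>
     bij \<phi> \<and> linear \<phi> \<and> \<phi> 1 = 1 \<and> (\<forall>a b. \<phi> (a * b) = \<phi> a * \<phi> b) \<and> (\<forall>a. norm (\<phi> a) = norm a)"

definition real_or_complex_field :: "'f::real_normed_field itself \<Rightarrow> bool" where
  "real_or_complex_field _ \<longleftrightarrow>
     (\<exists>\<phi> :: 'f \<Rightarrow> real. isometric_field_isomorphism \<phi>) \<or>
     (\<exists>\<phi> :: 'f \<Rightarrow> complex. isometric_field_isomorphism \<phi>)"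

lemma real_or_complex_field_real: "real_or_complex_field TYPE(real)"
proof -
  have "isometric_field_isomorphism (\<lambda>a::real. a)"
    by (auto simp: isometric_field_isomorphism_def bij_def inj_def linear_iff)
  then show ?thesis unfolding real_or_complex_field_def by blast
qed

lemma real_or_complex_field_complex: "real_or_complex_field TYPE(complex)"
proof -
  have "isometric_field_isomorphism (\<lambda>a::complex. a)"
    by (auto simp: isometric_field_isomorphism_def bij_def inj_def linear_iff)
  then show ?thesis unfolding real_or_complex_field_def by blast
qed

text \<open>
  The library has no class of complex Banach spaces, so the vector space structure over
  \<open>'f\<close> is given by an explicit scalar multiplication that extends the real one. The norm and
  completeness are those of the type class.
\<close>

locale banach_space_over = vector_space smul
  for smul :: "'f::real_normed_field \<Rightarrow> 'x::banach \<Rightarrow> 'x" +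
  assumes real_or_complex: "real_or_complex_field TYPE('f)"
    and norm_smul: "norm (smul a x) = norm a * norm x"
    and smul_of_real: "smul (of_real r) x = r *\<^sub>R x"

definition infinite_dimensional_over :: "('f::field \<Rightarrow> 'x::ab_group_add \<Rightarrow> 'x) \<Rightarrow> bool" where
  "infinite_dimensional_over smul \<longleftrightarrow> \<not> (\<exists>B. finite B \<and> module.span smul B = UNIV)"

definition dual_space ::
    "('f::real_normed_field \<Rightarrow> 'x::real_normed_vector \<Rightarrow> 'x) \<Rightarrow> ('x \<Rightarrow> 'f) set" where
  "dual_space smul = {f. Vector_Spaces.linear smul (*) f \<and> bounded_linear f}"

section \<open>Bases\<close>

text \<open>
  Sequences are indexed by \<^typ>\<open>nat\<close> from 0, so \<open>e i\<close> is the basis vector usually numbered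
  \<open>i + 1\<close>. The biorthogonal functionals \<open>es\<close> are carried along with the basis \<open>e\<close>, which
  determines them because its span is dense. The dual norm is \<^const>\<open>onorm\<close>.
\<close>

definition is_basis ::
    "('f::real_normed_field \<Rightarrow> 'x::real_normed_vector \<Rightarrow> 'x) \<Rightarrow> (nat \<Rightarrow> 'x) \<Rightarrow> (nat \<Rightarrow> 'x \<Rightarrow> 'f) \<Rightarrow> bool"
  where
  "is_basis smul e es \<longleftrightarrow>
     closure (module.span smul (range e)) = UNIV \<and>
     (\<forall>k. es k \<in> dual_space smul) \<and>
     (\<forall>k i. es k (e i) = (if k = i then 1 else 0)) \<and>
     0 < (INF i. min (norm (e i)) (onorm (es i))) \<and>
     bdd_above (range (\<lambda>i. max (norm (e i)) (onorm (es i))))"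

definition alpha1 :: "(nat \<Rightarrow> 'x::real_normed_vector) \<Rightarrow> real" where
  "alpha1 e = (SUP i. norm (e i))"

definition alpha2 :: "(nat \<Rightarrow> 'x::real_normed_vector \<Rightarrow> 'f::real_normed_field) \<Rightarrow> real" where
  "alpha2 es = (SUP i. onorm (es i))"

definition total_functionals :: "(nat \<Rightarrow> 'x::zero \<Rightarrow> 'f::zero) \<Rightarrow> bool" where
  "total_functionals es \<longleftrightarrow> (\<forall>x. (\<forall>i. es i x = 0) \<longrightarrow> x = 0)"

definition partial_sum_bound ::
    "('f::real_normed_field \<Rightarrow> 'x::real_normed_vector \<Rightarrow> 'x) \<Rightarrow> (nat \<Rightarrow> 'x) \<Rightarrow> (nat \<Rightarrow> 'x \<Rightarrow> 'f) \<Rightarrow> real \<Rightarrow> bool"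
  where
  "partial_sum_bound smul e es C \<longleftrightarrow>
     C > 0 \<and> (\<forall>x m. norm (\<Sum>i<m. smul (es i x) (e i)) \<le> C * norm x)"

definition is_schauder ::
    "('f::real_normed_field \<Rightarrow> 'x::real_normed_vector \<Rightarrow> 'x) \<Rightarrow> (nat \<Rightarrow> 'x) \<Rightarrow> (nat \<Rightarrow> 'x \<Rightarrow> 'f) \<Rightarrow> bool"
  where
  "is_schauder smul e es \<longleftrightarrow>
     is_basis smul e es \<and> total_functionals es \<and> (\<exists>C. partial_sum_bound smul e es C)"

definition has_basis_constant ::
    "('f::real_normed_field \<Rightarrow> 'x::real_normed_vector \<Rightarrow> 'x) \<Rightarrow> (nat \<Rightarrow> 'x) \<Rightarrow> (nat \<Rightarrow> 'x \<Rightarrow> 'f) \<Rightarrow> real \<Rightarrow> bool"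
  where
  "has_basis_constant smul e es K \<longleftrightarrow>
     partial_sum_bound smul e es K \<and> (\<forall>C. partial_sum_bound smul e es C \<longrightarrow> K \<le> C)"

section \<open>Sequences with gaps\<close>

text \<open>The sequence \<open>n\<^sub>1 < n\<^sub>2 < \<dots>\<close> is represented by \<open>n 0 < n 1 < \<dots>\<close>.\<close>

definition positive_increasing :: "(nat \<Rightarrow> nat) \<Rightarrow> bool" where
  "positive_increasing n \<longleftrightarrow> strict_mono n \<and> (\<forall>k. n k > 0)"

definition bounded_additive_gaps :: "nat \<Rightarrow> (nat \<Rightarrow> nat) \<Rightarrow> bool" where
  "bounded_additive_gaps l n \<longleftrightarrow> (\<forall>k. int (n (Suc k)) - int (n k) \<le> int l)"

definition bounded_quotient_gaps :: "nat \<Rightarrow> (nat \<Rightarrow> nat) \<Rightarrow> bool" where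
  "bounded_quotient_gaps l n \<longleftrightarrow> (\<forall>k. real (n (Suc k)) / real (n k) \<le> real l)"

section \<open>Unconditionality for constant coefficients\<close>

text \<open>Families indexed by \<open>A\<close> are functions on \<^typ>\<open>nat\<close>; their values outside \<open>A\<close> are irrelevant.\<close>

definition unimodular_families :: "nat set \<Rightarrow> (nat \<Rightarrow> 'f::real_normed_field) set" where
  "unimodular_families A = {\<epsilon>. \<forall>i\<in>A. norm (\<epsilon> i) = 1}"

definition signed_indicator ::
    "('f \<Rightarrow> 'x::comm_monoid_add \<Rightarrow> 'x) \<Rightarrow> (nat \<Rightarrow> 'x) \<Rightarrow> (nat \<Rightarrow> 'f) \<Rightarrow> nat set \<Rightarrow> 'x" where
  "signed_indicator smul e \<epsilon> A = (\<Sum>i\<in>A. smul (\<epsilon> i) (e i))"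

definition unconditional_cc_bound ::
    "('f::real_normed_field \<Rightarrow> 'x::real_normed_vector \<Rightarrow> 'x) \<Rightarrow> (nat \<Rightarrow> 'x) \<Rightarrow> nat set \<Rightarrow> real \<Rightarrow> bool" where
  "unconditional_cc_bound smul e N C \<longleftrightarrow>
     C > 0 \<and>
     (\<forall>A. finite A \<and> card A \<in> N \<longrightarrow>
        (\<forall>\<epsilon>\<in>unimodular_families A. \<forall>\<epsilon>'\<in>unimodular_families A.
           norm (signed_indicator smul e \<epsilon> A) \<le> C * norm (signed_indicator smul e \<epsilon>' A)))"

text \<open>The constant of unconditionality is the least admissible one.\<close>

definition unconditional_cc ::
    "('f::real_normed_field \<Rightarrow> 'x::real_normed_vector \<Rightarrow> 'x) \<Rightarrow> (nat \<Rightarrow> 'x) \<Rightarrow> nat set \<Rightarrow> real \<Rightarrow> bool" where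
  "unconditional_cc smul e N K \<longleftrightarrow>
     unconditional_cc_bound smul e N K \<and>
     (\<forall>C. unconditional_cc_bound smul e N C \<longrightarrow> K \<le> C)"

end

theory Submission
  imports Defs
begin

text \<open>
  The idea is to compare a finite set \<open>A\<close> with sets whose cardinality does lie in \<open>\<n>\<close>.
  If \<open>A\<close> has fewer than \<open>n\<^sub>1\<close> elements, the crude estimates
  \<open>1 / \<alpha>\<^sub>2 \<le> \<parallel>1\<^bsub>\<epsilon>A\<^esub>\<parallel> \<le> \<bar>A\<bar> \<alpha>\<^sub>1\<close> suffice. Otherwise \<open>n\<^sub>k \<le> \<bar>A\<bar> < n\<^bsub>k+1\<^esub>\<close> for some \<open>k\<close>.

  With bounded additive gaps, \<open>A\<close> differs from a subset with \<open>n\<^sub>k\<close> elements by fewer than \<open>l\<close>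
  points. Dropping these changes either norm by at most \<open>l \<alpha>\<^sub>1\<close>, hence by at most
  \<open>l \<alpha>\<^sub>1 \<alpha>\<^sub>2\<close> times the norm of any signed indicator of \<open>A\<close>.

  With bounded quotient gaps, cut \<open>A\<close> from left to right into at most \<open>l\<close> consecutive blocks of
  \<open>n\<^sub>k\<close> elements, the last one possibly shorter. Signs on a full block may be changed at the cost
  of \<open>K\<^sub>u\<close>. The projection of \<open>1\<^bsub>\<epsilon>'A\<^esub>\<close> onto the first block costs the basis constant \<open>K\<close>, and onto
  every later one, as a difference of two partial sums, \<open>2K\<close>. This gives
  \<open>K\<^sub>u K + 2 (l - 1) K\<^sub>u K\<close>. The short block \<open>R\<close> is no exception: it lies in the block \<open>D\<close> of the
  last \<open>n\<^sub>k\<close> elements of \<open>A\<close>, and \<open>1\<^bsub>\<epsilon>R\<^esub>\<close> is the mean of two signed indicators of \<open>D\<close>, the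
  contributions outside \<open>R\<close> cancelling. This is the content of
  \<open>norm_signed_indicator_subset_le\<close>, and the induction over blocks is
  \<open>norm_signed_indicator_tail_le\<close>.
\<close>

section \<open>Combinatorics of index sets\<close>

text \<open>The cardinality of an initial segment grows by at most one at each step, so it takes every
  value up to the cardinality of the whole set.\<close>

lemma ex_card_Int_lessThan:
  fixes A :: "nat set"
  assumes "finite A" and "k \<le> card A"
  shows "\<exists>c. card (A \<inter> {..<c}) = k"
proof -
  obtain M where M: "A \<subseteq> {..<M}"
    using assms(1) finite_nat_iff_bounded by blast
  have "\<exists>c. card (A \<inter> {..<c}) = k" if "k \<le> card (A \<inter> {..<m})" for m
    using that
  proof (induction m)
    case (Suc m)
    show ?case
    proof (cases "k \<le> card (A \<inter> {..<m})")
      case False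
      have "card (A \<inter> {..<Suc m}) \<le> card (insert m (A \<inter> {..<m}))"
        by (rule card_mono) (auto simp: less_Suc_eq)
      also have "\<dots> \<le> Suc (card (A \<inter> {..<m}))"
        by (simp add: card_insert_if)
      finally have "k = card (A \<inter> {..<Suc m})"
        using Suc.prems False by linarith
      then show ?thesis by blast
    qed (use Suc.IH in blast)
  qed auto
  moreover have "A \<inter> {..<M} = A" using M by blast
  ultimately show ?thesis using assms(2) by metis
qed

lemma strict_mono_bracket:
  fixes n :: "nat \<Rightarrow> nat"
  assumes "strict_mono n" and "n 0 \<le> m"
  shows "\<exists>k. n k \<le> m \<and> m < n (Suc k)"
proof -
  have "\<exists>j. m < n j"
    using seq_suble[OF assms(1), of "Suc m"] by (intro exI[of _ "Suc m"]) simp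
  then obtain j where j: "m < n j" "\<And>i. i < j \<Longrightarrow> \<not> m < n i"
    using exists_least_iff[of "\<lambda>j. m < n j"] by blast
  then obtain k where "j = Suc k"
    using assms(2) by (cases j) auto
  with j have "n k \<le> m \<and> m < n (Suc k)" by (auto simp: not_less)
  then show ?thesis ..
qed

section \<open>Norms of signed indicators\<close>

lemma unimodular_families_mono:
  "\<epsilon> \<in> unimodular_families A \<Longrightarrow> B \<subseteq> A \<Longrightarrow> \<epsilon> \<in> unimodular_families B"
  by (auto simp: unimodular_families_def)

lemma signed_indicator_Un_disjoint:
  "finite A \<Longrightarrow> finite B \<Longrightarrow> A \<inter> B = {} \<Longrightarrow>
     signed_indicator smul e \<epsilon> (A \<union> B) = signed_indicator smul e \<epsilon> A + signed_indicator smul e \<epsilon> B"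
  unfolding signed_indicator_def by (rule sum.union_disjoint)

locale basis_over = banach_space_over smul
  for smul :: "'f::real_normed_field \<Rightarrow> 'x::banach \<Rightarrow> 'x" +
  fixes e :: "nat \<Rightarrow> 'x" and es :: "nat \<Rightarrow> 'x \<Rightarrow> 'f"
  assumes basis: "is_basis smul e es"
begin

lemma bdd_above_norms:
  shows bdd_above_norm: "bdd_above (range (\<lambda>i. norm (e i)))"
    and bdd_above_onorm: "bdd_above (range (\<lambda>i. onorm (es i)))"
proof -
  have "bdd_above (range (\<lambda>i. max (norm (e i)) (onorm (es i))))"
    using basis by (simp add: is_basis_def)
  then obtain M where "\<And>i. max (norm (e i)) (onorm (es i)) \<le> M"
    by (auto simp: bdd_above_def)
  then show "bdd_above (range (\<lambda>i. norm (e i)))" "bdd_above (range (\<lambda>i. onorm (es i)))"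
    by (auto simp: bdd_above_def)
qed

lemma norm_basis_le: "norm (e i) \<le> alpha1 e"
  unfolding alpha1_def by (rule cSUP_upper[OF UNIV_I bdd_above_norm])

lemma onorm_functional_le: "onorm (es i) \<le> alpha2 es"
  unfolding alpha2_def by (rule cSUP_upper[OF UNIV_I bdd_above_onorm])

lemma alpha1_nonneg: "0 \<le> alpha1 e"
  using norm_ge_zero norm_basis_le by (rule order_trans)

lemma functional_basis: "es k (e i) = (if k = i then 1 else 0)"
  using basis by (simp add: is_basis_def)

lemma bounded_linear_functional: "bounded_linear (es k)"
  using basis by (simp add: is_basis_def dual_space_def)

lemma functional_smul: "es k (smul a x) = a * es k x"
proof -
  have "Vector_Spaces.linear smul (*) (es k)"
    using basis by (simp add: is_basis_def dual_space_def)
  then interpret f: Vector_Spaces.linear smul "(*)" "es k" .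
  show ?thesis by (rule f.scale)
qed

lemma norm_functional_le: "norm (es k x) \<le> alpha2 es * norm x"
  using onorm[OF bounded_linear_functional[of k], of x]
    mult_right_mono[OF onorm_functional_le[of k] norm_ge_zero[of x]] by linarith

lemma functional_signed_indicator:
  assumes "finite A"
  shows "es k (signed_indicator smul e \<epsilon> A) = (if k \<in> A then \<epsilon> k else 0)"
proof -
  have "es k (signed_indicator smul e \<epsilon> A) = (\<Sum>i\<in>A. es k (smul (\<epsilon> i) (e i)))"
    unfolding signed_indicator_def
    by (rule linear_sum[OF bounded_linear.linear[OF bounded_linear_functional]])
  also have "\<dots> = (\<Sum>i\<in>A. if k = i then \<epsilon> i else 0)"
    by (rule sum.cong) (auto simp: functional_smul functional_basis)
  finally show ?thesis using assms by simp
qed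

lemma norm_signed_indicator_le:
  assumes "\<epsilon> \<in> unimodular_families A"
  shows "norm (signed_indicator smul e \<epsilon> A) \<le> real (card A) * alpha1 e"
proof -
  have "norm (\<Sum>i\<in>A. smul (\<epsilon> i) (e i)) \<le> (\<Sum>i\<in>A. alpha1 e)"
    using assms
    by (intro sum_norm_le) (simp add: norm_smul norm_basis_le unimodular_families_def)
  then show ?thesis by (simp add: signed_indicator_def)
qed

text \<open>Every coefficient functional with index in \<open>A\<close> takes a value of modulus one on the signed
  indicator, which therefore cannot be small.\<close>

lemma one_le_norm_signed_indicator:
  assumes "finite A" and "A \<noteq> {}" and "\<epsilon> \<in> unimodular_families A"
  shows "1 \<le> alpha2 es * norm (signed_indicator smul e \<epsilon> A)"
proof -
  obtain k where "k \<in> A" using assms(2) by blast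
  then have "norm (es k (signed_indicator smul e \<epsilon> A)) = 1"
    using assms by (simp add: functional_signed_indicator unimodular_families_def)
  then show ?thesis
    using norm_functional_le[of k "signed_indicator smul e \<epsilon> A"] by simp
qed

text \<open>Consequently any quantity bounded by a multiple of \<open>\<alpha>\<^sub>1\<close> can be absorbed into the norm of
  a signed indicator.\<close>

lemma alpha1_le_norm_signed_indicator:
  assumes "finite A" and "A \<noteq> {}" and "\<epsilon> \<in> unimodular_families A" and "0 \<le> r"
  shows "r * alpha1 e \<le> r * alpha1 e * alpha2 es * norm (signed_indicator smul e \<epsilon> A)"
  using mult_left_mono[OF one_le_norm_signed_indicator[OF assms(1-3)], of "r * alpha1 e"]
    assms(4) alpha1_nonneg by (simp add: mult.assoc)

text \<open>An admissible constant can be lowered to a least one. The infimum of the admissible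
  constants is itself admissible because singletons keep it at least \<open>1\<close>.\<close>

lemma unconditional_cc_least:
  assumes bound: "\<And>A \<epsilon> \<epsilon>'. finite A \<Longrightarrow> A \<noteq> {} \<Longrightarrow>
      \<epsilon> \<in> unimodular_families A \<Longrightarrow> \<epsilon>' \<in> unimodular_families A \<Longrightarrow>
      norm (signed_indicator smul e \<epsilon> A) \<le> B * norm (signed_indicator smul e \<epsilon>' A)"
  shows "\<exists>C. unconditional_cc smul e {1..} C \<and> C \<le> B"
proof -
  define S where "S = {C. unconditional_cc_bound smul e {1..} C}"
  have one: "(\<lambda>_. 1 :: 'f) \<in> unimodular_families {0}"
    by (simp add: unimodular_families_def)
  have pos: "0 < norm (signed_indicator smul e (\<lambda>_. 1 :: 'f) {0})"
    using one_le_norm_signed_indicator[OF _ _ one]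
    by (cases "signed_indicator smul e (\<lambda>_. 1 :: 'f) {0} = 0") auto
  have "1 \<le> B"
    using bound[OF _ _ one one] pos by simp
  then have "B \<in> S"
    unfolding S_def unconditional_cc_bound_def using bound by force
  have ge1: "1 \<le> C" if "C \<in> S" for C
  proof -
    have "norm (signed_indicator smul e (\<lambda>_. 1 :: 'f) {0})
        \<le> C * norm (signed_indicator smul e (\<lambda>_. 1 :: 'f) {0})"
      using that one unfolding S_def unconditional_cc_bound_def by auto
    with pos show ?thesis by simp
  qed
  then have bdd: "bdd_below S" by (auto simp: bdd_below_def)
  have "1 \<le> Inf S"
    using \<open>B \<in> S\<close> ge1 by (intro cInf_greatest) auto
  moreover have "norm (signed_indicator smul e \<epsilon> A) \<le> Inf S * norm (signed_indicator smul e \<epsilon>' A)"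
    if A: "finite A" "card A \<in> {1..}"
      and \<epsilon>: "\<epsilon> \<in> unimodular_families A" "\<epsilon>' \<in> unimodular_families A" for A \<epsilon> \<epsilon>'
  proof -
    have "A \<noteq> {}" using A by auto
    then have "norm (signed_indicator smul e \<epsilon>' A) \<noteq> 0"
      using one_le_norm_signed_indicator[OF A(1) _ \<epsilon>(2)] by auto
    then have p: "0 < norm (signed_indicator smul e \<epsilon>' A)" by simp
    have "norm (signed_indicator smul e \<epsilon> A) / norm (signed_indicator smul e \<epsilon>' A) \<le> Inf S"
    proof (rule cInf_greatest)
      fix C assume "C \<in> S"
      then have "norm (signed_indicator smul e \<epsilon> A) \<le> C * norm (signed_indicator smul e \<epsilon>' A)"
        using A \<epsilon> unfolding S_def unconditional_cc_bound_def by blast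
      with p show "norm (signed_indicator smul e \<epsilon> A) / norm (signed_indicator smul e \<epsilon>' A) \<le> C"
        by (simp add: divide_le_eq)
    qed (use \<open>B \<in> S\<close> in auto)
    with p show ?thesis by (simp add: divide_le_eq)
  qed
  ultimately have "unconditional_cc_bound smul e {1..} (Inf S)"
    unfolding unconditional_cc_bound_def by force
  moreover have "Inf S \<le> C" if "C \<in> S" for C
    using that bdd by (rule cInf_lower)
  ultimately show ?thesis
    using \<open>B \<in> S\<close> unfolding unconditional_cc_def S_def by blast
qed

lemma unconditional_cc_boundD:
  assumes "unconditional_cc_bound smul e N C" and "finite A" and "card A \<in> N"
    and "\<epsilon> \<in> unimodular_families A" and "\<epsilon>' \<in> unimodular_families A"
  shows "norm (signed_indicator smul e \<epsilon> A) \<le> C * norm (signed_indicator smul e \<epsilon>' A)"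
  using assms unfolding unconditional_cc_bound_def by blast

text \<open>The triangle inequality bounds the left side by \<open>\<bar>A\<bar> \<alpha>\<^sub>1\<close>, and a coefficient functional
  bounds the norm on the right from below by \<open>1 / \<alpha>\<^sub>2\<close>. Only the number of elements matters, so
  this handles the sets with fewer elements than every term of the sequence.\<close>

lemma norm_signed_indicator_card_less:
  assumes "finite A" and "A \<noteq> {}" and "card A < m"
    and "\<epsilon> \<in> unimodular_families A" and "\<epsilon>' \<in> unimodular_families A"
  shows "norm (signed_indicator smul e \<epsilon> A)
      \<le> ((real m - 1) * alpha1 e * alpha2 es) * norm (signed_indicator smul e \<epsilon>' A)"
proof -
  have "real (card A) \<le> real m - 1" using assms(3) by linarith
  have "norm (signed_indicator smul e \<epsilon> A) \<le> real (card A) * alpha1 e"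
    using assms(4) by (rule norm_signed_indicator_le)
  also have "\<dots> \<le> (real m - 1) * alpha1 e"
    using \<open>real (card A) \<le> real m - 1\<close> alpha1_nonneg by (rule mult_right_mono)
  also have "\<dots> \<le> (real m - 1) * alpha1 e * alpha2 es * norm (signed_indicator smul e \<epsilon>' A)"
    using assms(1,2,5) \<open>real (card A) \<le> real m - 1\<close>
    by (intro alpha1_le_norm_signed_indicator) auto
  finally show ?thesis .
qed

lemma unconditional_cc_of_large:
  assumes large: "\<And>A \<epsilon> \<epsilon>'. finite A \<Longrightarrow> A \<noteq> {} \<Longrightarrow> m \<le> card A \<Longrightarrow>
      \<epsilon> \<in> unimodular_families A \<Longrightarrow> \<epsilon>' \<in> unimodular_families A \<Longrightarrow>
      norm (signed_indicator smul e \<epsilon> A) \<le> B * norm (signed_indicator smul e \<epsilon>' A)"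
  shows "\<exists>C. unconditional_cc smul e {1..} C \<and> C \<le> max ((real m - 1) * alpha1 e * alpha2 es) B"
proof (rule unconditional_cc_least)
  fix A and \<epsilon> \<epsilon>' :: "nat \<Rightarrow> 'f"
  assume A: "finite A" "A \<noteq> {}"
    and \<epsilon>: "\<epsilon> \<in> unimodular_families A" "\<epsilon>' \<in> unimodular_families A"
  let ?S = "(real m - 1) * alpha1 e * alpha2 es"
  have "norm (signed_indicator smul e \<epsilon> A) \<le> ?S * norm (signed_indicator smul e \<epsilon>' A)
      \<or> norm (signed_indicator smul e \<epsilon> A) \<le> B * norm (signed_indicator smul e \<epsilon>' A)"
    using norm_signed_indicator_card_less[OF A _ \<epsilon>] large[OF A _ \<epsilon>] by (meson not_less)
  moreover have "?S * norm (signed_indicator smul e \<epsilon>' A)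
      \<le> max ?S B * norm (signed_indicator smul e \<epsilon>' A)"
    and "B * norm (signed_indicator smul e \<epsilon>' A)
      \<le> max ?S B * norm (signed_indicator smul e \<epsilon>' A)"
    by (simp_all add: mult_right_mono)
  ultimately show "norm (signed_indicator smul e \<epsilon> A)
      \<le> max ?S B * norm (signed_indicator smul e \<epsilon>' A)"
    by linarith
qed

section \<open>Additive gaps\<close>

text \<open>The points outside \<open>D\<close> are split off before and after the change of signs on \<open>D\<close>,
  each time at the cost of at most \<open>l \<alpha>\<^sub>1\<close>. The second loss is multiplied by \<open>K\<close>.\<close>

lemma norm_signed_indicator_additive:
  assumes K: "unconditional_cc_bound smul e N K"
    and A: "finite A" "A \<noteq> {}" and D: "D \<subseteq> A" "card D \<in> N" and l: "card (A - D) \<le> l"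
    and \<epsilon>: "\<epsilon> \<in> unimodular_families A" "\<epsilon>' \<in> unimodular_families A"
  shows "norm (signed_indicator smul e \<epsilon> A)
      \<le> (K + K * real l * alpha1 e * alpha2 es + real l * alpha1 e * alpha2 es)
         * norm (signed_indicator smul e \<epsilon>' A)"
proof -
  let ?I = "signed_indicator smul e"
  let ?b = "real l * alpha1 e"
  have "0 < K" using K by (simp add: unconditional_cc_bound_def)
  have fin: "finite D" "finite (A - D)" using A D finite_subset by auto
  have split: "?I \<delta> A = ?I \<delta> D + ?I \<delta> (A - D)" for \<delta>
    using signed_indicator_Un_disjoint[OF fin, of smul e \<delta>] D by (simp add: Un_absorb1)
  have rest: "norm (?I \<delta> (A - D)) \<le> ?b" if "\<delta> \<in> unimodular_families A" for \<delta>
  proof -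
    have "\<delta> \<in> unimodular_families (A - D)"
      using that by (rule unimodular_families_mono) blast
    then have "norm (?I \<delta> (A - D)) \<le> real (card (A - D)) * alpha1 e"
      by (rule norm_signed_indicator_le)
    also have "\<dots> \<le> ?b" using l alpha1_nonneg by (simp add: mult_right_mono)
    finally show ?thesis .
  qed
  have "norm (?I \<epsilon> A) \<le> norm (?I \<epsilon> D) + ?b"
    unfolding split[of \<epsilon>] using norm_triangle_ineq rest[OF \<epsilon>(1)] by (meson add_left_mono order_trans)
  moreover have "norm (?I \<epsilon> D) \<le> K * norm (?I \<epsilon>' D)"
    using K fin(1) D(2) \<epsilon>[THEN unimodular_families_mono, OF D(1)]
    by (rule unconditional_cc_boundD)
  moreover have "norm (?I \<epsilon>' D) \<le> norm (?I \<epsilon>' A) + ?b"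
    using norm_triangle_ineq4[of "?I \<epsilon>' A" "?I \<epsilon>' (A - D)"] rest[OF \<epsilon>(2)] split[of \<epsilon>'] by simp
  then have "K * norm (?I \<epsilon>' D) \<le> K * (norm (?I \<epsilon>' A) + ?b)"
    using \<open>0 < K\<close> by simp
  moreover have absorb: "?b \<le> ?b * alpha2 es * norm (?I \<epsilon>' A)"
    using A \<epsilon>(2) by (intro alpha1_le_norm_signed_indicator) auto
  moreover have "K * ?b \<le> K * (?b * alpha2 es * norm (?I \<epsilon>' A))"
    using absorb \<open>0 < K\<close> by simp
  ultimately have "norm (?I \<epsilon> A) \<le> K * norm (?I \<epsilon>' A)
      + K * (?b * alpha2 es * norm (?I \<epsilon>' A)) + ?b * alpha2 es * norm (?I \<epsilon>' A)"
    by (simp add: distrib_left)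
  then show ?thesis by (simp add: algebra_simps)
qed

section \<open>Quotient gaps\<close>

text \<open>Flipping the signs outside \<open>R\<close> and averaging removes \<open>D - R\<close>: unconditionality for constant
  coefficients on \<open>D\<close> also bounds the signed indicators of subsets of \<open>D\<close>, whatever
  their cardinality.\<close>

lemma norm_signed_indicator_subset_le:
  assumes K: "unconditional_cc_bound smul e N K"
    and D: "finite D" "card D \<in> N" and R: "R \<subseteq> D"
    and \<epsilon>: "\<epsilon> \<in> unimodular_families D" "\<epsilon>' \<in> unimodular_families D"
  shows "norm (signed_indicator smul e \<epsilon> R) \<le> K * norm (signed_indicator smul e \<epsilon>' D)"
proof -
  let ?I = "signed_indicator smul e"
  define \<delta> where "\<delta> i = (if i \<in> R then \<epsilon> i else - \<epsilon> i)" for i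
  have \<delta>: "\<delta> \<in> unimodular_families D"
    using \<epsilon>(1) by (auto simp: unimodular_families_def \<delta>_def)
  have fin: "finite R" "finite (D - R)" using D(1) R finite_subset by auto
  have split: "?I \<eta> D = ?I \<eta> R + ?I \<eta> (D - R)" for \<eta>
    using signed_indicator_Un_disjoint[OF fin, of smul e \<eta>] R by (simp add: Un_absorb1)
  have "?I \<delta> R = ?I \<epsilon> R"
    unfolding signed_indicator_def by (rule sum.cong) (auto simp: \<delta>_def)
  moreover have "?I \<delta> (D - R) = - ?I \<epsilon> (D - R)"
    unfolding signed_indicator_def sum_negf[symmetric] by (rule sum.cong) (auto simp: \<delta>_def)
  ultimately have "?I \<epsilon> D + ?I \<delta> D = 2 *\<^sub>R ?I \<epsilon> R"
    unfolding split[of \<epsilon>] split[of \<delta>] by (simp add: scaleR_2)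
  then have "2 * norm (?I \<epsilon> R) = norm (?I \<epsilon> D + ?I \<delta> D)" by simp
  also have "\<dots> \<le> norm (?I \<epsilon> D) + norm (?I \<delta> D)" by (rule norm_triangle_ineq)
  also have "\<dots> \<le> K * norm (?I \<epsilon>' D) + K * norm (?I \<epsilon>' D)"
    using unconditional_cc_boundD[OF K D \<epsilon>] unconditional_cc_boundD[OF K D \<delta> \<epsilon>(2)]
    by (rule add_mono)
  finally show ?thesis by simp
qed

lemma norm_signed_indicator_initial_le:
  assumes K: "partial_sum_bound smul e es K" and A: "finite A"
  shows "norm (signed_indicator smul e \<epsilon> (A \<inter> {..<c})) \<le> K * norm (signed_indicator smul e \<epsilon> A)"
proof -
  let ?x = "signed_indicator smul e \<epsilon> A"
  have "(\<Sum>i<c. smul (es i ?x) (e i)) = (\<Sum>i<c. if i \<in> A then smul (\<epsilon> i) (e i) else 0)"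
    by (rule sum.cong) (auto simp: functional_signed_indicator[OF A])
  also have "\<dots> = signed_indicator smul e \<epsilon> (A \<inter> {..<c})"
    unfolding signed_indicator_def by (simp add: sum.inter_restrict[symmetric] Int_commute)
  finally show ?thesis using K by (metis partial_sum_bound_def)
qed

lemma norm_signed_indicator_interval_le:
  assumes K: "partial_sum_bound smul e es K" and A: "finite A"
  shows "norm (signed_indicator smul e \<epsilon> (A \<inter> {a..<b})) \<le> 2 * K * norm (signed_indicator smul e \<epsilon> A)"
proof (cases "a \<le> b")
  case True
  let ?I = "signed_indicator smul e \<epsilon>"
  have "A \<inter> {..<b} = A \<inter> {..<a} \<union> A \<inter> {a..<b}" using True by auto
  moreover have "(A \<inter> {..<a}) \<inter> (A \<inter> {a..<b}) = {}" by auto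
  ultimately have "?I (A \<inter> {a..<b}) = ?I (A \<inter> {..<b}) - ?I (A \<inter> {..<a})"
    using A by (simp add: signed_indicator_Un_disjoint)
  then have "norm (?I (A \<inter> {a..<b})) \<le> norm (?I (A \<inter> {..<b})) + norm (?I (A \<inter> {..<a}))"
    by (simp add: norm_triangle_ineq4)
  then show ?thesis
    using norm_signed_indicator_initial_le[OF assms, of \<epsilon> a]
      norm_signed_indicator_initial_le[OF assms, of \<epsilon> b] by linarith
next
  case False
  then show ?thesis using K by (simp add: signed_indicator_def partial_sum_bound_def)
qed

text \<open>The signs are changed on the whole block, which contains \<open>R\<close> and has an admissible
  cardinality; its indicator with the new signs is a projection of \<open>1\<^bsub>\<epsilon>'A\<^esub>\<close>, a difference of two
  partial sums.\<close>

lemma norm_signed_indicator_block_le: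
  assumes Ku: "unconditional_cc_bound smul e N Ku" and K: "partial_sum_bound smul e es K"
    and A: "finite A" and D: "card (A \<inter> {a..<b}) \<in> N" and R: "R \<subseteq> A \<inter> {a..<b}"
    and \<epsilon>: "\<epsilon> \<in> unimodular_families A" "\<epsilon>' \<in> unimodular_families A"
  shows "norm (signed_indicator smul e \<epsilon> R) \<le> 2 * Ku * K * norm (signed_indicator smul e \<epsilon>' A)"
proof -
  let ?D = "A \<inter> {a..<b}"
  have "norm (signed_indicator smul e \<epsilon> R) \<le> Ku * norm (signed_indicator smul e \<epsilon>' ?D)"
    using A \<epsilon>[THEN unimodular_families_mono]
    by (intro norm_signed_indicator_subset_le[OF Ku _ D R]) auto
  also have "\<dots> \<le> Ku * (2 * K * norm (signed_indicator smul e \<epsilon>' A))"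
    using norm_signed_indicator_interval_le[OF K A] Ku
    by (intro mult_left_mono) (auto simp: unconditional_cc_bound_def)
  finally show ?thesis by (simp add: mult_ac)
qed

text \<open>A tail of \<open>A\<close> that fits into \<open>j\<close> blocks of \<open>p\<close> elements costs \<open>j\<close> times as much as a single
  block. As long as more than \<open>p\<close> elements are left, a full block is removed on the left; fewer
  elements are completed to a full block by points of \<open>A\<close> to their left.\<close>

lemma norm_signed_indicator_tail_le:
  assumes Ku: "unconditional_cc_bound smul e N Ku" and K: "partial_sum_bound smul e es K"
    and A: "finite A" and p: "p \<in> N" "p \<le> card A"
    and \<epsilon>: "\<epsilon> \<in> unimodular_families A" "\<epsilon>' \<in> unimodular_families A"
  shows "card (A \<inter> {c..}) \<le> j * p \<Longrightarrow>
     norm (signed_indicator smul e \<epsilon> (A \<inter> {c..}))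
       \<le> real j * (2 * Ku * K * norm (signed_indicator smul e \<epsilon>' A))"
proof (induction j arbitrary: c)
  case 0
  then have "A \<inter> {c..} = {}" using A by simp
  then show ?case by (simp add: signed_indicator_def)
next
  case (Suc j)
  let ?I = "signed_indicator smul e"
  let ?T = "2 * Ku * K * norm (?I \<epsilon>' A)"
  have "0 \<le> ?T"
    using Ku K by (simp add: unconditional_cc_bound_def partial_sum_bound_def)
  show ?case
  proof (cases "card (A \<inter> {c..}) \<le> p")
    case True
    have card: "card A = card (A \<inter> {..<d}) + card (A \<inter> {d..})" for d
    proof -
      have "A = A \<inter> {..<d} \<union> A \<inter> {d..}" by auto
      then show ?thesis using A
        by (metis card_Un_disjoint finite_Int disjoint_iff IntD2 lessThan_iff atLeast_iff not_le)
    qed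
    have "card A - p \<le> card (A \<inter> {..<c})" using True card[of c] by linarith
    then obtain d where d: "card (A \<inter> {..<c} \<inter> {..<d}) = card A - p"
      using ex_card_Int_lessThan[of "A \<inter> {..<c}"] A by blast
    obtain M where M: "A \<subseteq> {..<M}" using A finite_nat_iff_bounded by blast
    have "A \<inter> {..<c} \<inter> {..<d} = A \<inter> {..<min c d}" by auto
    then have "card (A \<inter> {min c d..}) = p" using d card[of "min c d"] p(2) by simp
    moreover have "A \<inter> {min c d..} = A \<inter> {min c d..<M}" using M by auto
    ultimately have "card (A \<inter> {min c d..<M}) \<in> N" using p(1) by simp
    moreover have "A \<inter> {c..} \<subseteq> A \<inter> {min c d..<M}" using M by auto
    ultimately have "norm (?I \<epsilon> (A \<inter> {c..})) \<le> ?T"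
      by (rule norm_signed_indicator_block_le[OF Ku K A _ _ \<epsilon>])
    also have "\<dots> \<le> real (Suc j) * ?T"
      using mult_right_mono[OF _ \<open>0 \<le> ?T\<close>, of 1 "real (Suc j)"] by simp
    finally show ?thesis .
  next
    case False
    then have "p \<le> card (A \<inter> {c..})" by simp
    then obtain d where d: "card (A \<inter> {c..} \<inter> {..<d}) = p"
      using ex_card_Int_lessThan[of "A \<inter> {c..}"] A by blast
    have block: "A \<inter> {c..} \<inter> {..<d} = A \<inter> {c..<d}" by auto
    have split: "A \<inter> {c..} = A \<inter> {c..<d} \<union> A \<inter> {max c d..}" by auto
    have disj: "(A \<inter> {c..<d}) \<inter> (A \<inter> {max c d..}) = {}" by auto
    have "card (A \<inter> {c..}) = p + card (A \<inter> {max c d..})"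
      using card_Un_disjoint[OF _ _ disj] A d unfolding block split[symmetric] by simp
    then have "card (A \<inter> {max c d..}) \<le> j * p" using Suc.prems by simp
    then have "norm (?I \<epsilon> (A \<inter> {max c d..})) \<le> real j * ?T" by (rule Suc.IH)
    moreover have "norm (?I \<epsilon> (A \<inter> {c..<d})) \<le> ?T"
      using d block p(1) by (intro norm_signed_indicator_block_le[OF Ku K A _ order_refl \<epsilon>]) simp
    moreover have "norm (?I \<epsilon> (A \<inter> {c..}))
        \<le> norm (?I \<epsilon> (A \<inter> {c..<d})) + norm (?I \<epsilon> (A \<inter> {max c d..}))"
      using signed_indicator_Un_disjoint[OF _ _ disj, of smul e \<epsilon>] A norm_triangle_ineq
      unfolding split[symmetric] by simp
    ultimately show ?thesis by (simp add: distrib_right)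
  qed
qed

lemma norm_signed_indicator_quotient:
  assumes Ku: "unconditional_cc_bound smul e N Ku" and K: "partial_sum_bound smul e es K"
    and A: "finite A" and p: "p \<in> N" "p \<le> card A" and l: "card A \<le> l * p" "l \<ge> 1"
    and \<epsilon>: "\<epsilon> \<in> unimodular_families A" "\<epsilon>' \<in> unimodular_families A"
  shows "norm (signed_indicator smul e \<epsilon> A)
      \<le> ((2 * real l - 1) * Ku * K) * norm (signed_indicator smul e \<epsilon>' A)"
proof -
  let ?I = "signed_indicator smul e"
  obtain c where c: "card (A \<inter> {..<c}) = p"
    using ex_card_Int_lessThan[OF A p(2)] by blast
  have split: "A = A \<inter> {..<c} \<union> A \<inter> {c..}" by auto
  have disj: "(A \<inter> {..<c}) \<inter> (A \<inter> {c..}) = {}" by auto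
  have "card A = p + card (A \<inter> {c..})"
    using card_Un_disjoint[OF _ _ disj] A c unfolding split[symmetric] by simp
  then have "card (A \<inter> {c..}) \<le> (l - 1) * p" using l by (simp add: diff_mult_distrib)
  then have "norm (?I \<epsilon> (A \<inter> {c..})) \<le> real (l - 1) * (2 * Ku * K * norm (?I \<epsilon>' A))"
    by (rule norm_signed_indicator_tail_le[OF Ku K A p \<epsilon>])
  \<comment> \<open>The first block is an initial segment, so projecting onto it costs \<open>K\<close> instead of \<open>2K\<close>.\<close>
  moreover have "norm (?I \<epsilon> (A \<inter> {..<c})) \<le> Ku * norm (?I \<epsilon>' (A \<inter> {..<c}))"
    using A c p(1) \<epsilon>[THEN unimodular_families_mono]
    by (intro unconditional_cc_boundD[OF Ku]) auto
  moreover have "Ku * norm (?I \<epsilon>' (A \<inter> {..<c})) \<le> Ku * (K * norm (?I \<epsilon>' A))"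
    using norm_signed_indicator_initial_le[OF K A] Ku
    by (intro mult_left_mono) (auto simp: unconditional_cc_bound_def)
  moreover have "norm (?I \<epsilon> A) \<le> norm (?I \<epsilon> (A \<inter> {..<c})) + norm (?I \<epsilon> (A \<inter> {c..}))"
    using signed_indicator_Un_disjoint[OF _ _ disj, of smul e \<epsilon>] A norm_triangle_ineq
    unfolding split[symmetric] by simp
  ultimately have "norm (?I \<epsilon> A) \<le> Ku * (K * norm (?I \<epsilon>' A))
      + real (l - 1) * (2 * Ku * K * norm (?I \<epsilon>' A))"
    by linarith
  then show ?thesis using l(2) by (simp add: of_nat_diff algebra_simps)
qed

end

section \<open>Passing from the sequence to all cardinalities\<close>

theorem proposition2p2:
  fixes smul :: "'f::real_normed_field \<Rightarrow> 'x::banach \<Rightarrow> 'x"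
    and e :: "nat \<Rightarrow> 'x" and es :: "nat \<Rightarrow> 'x \<Rightarrow> 'f"
    and n :: "nat \<Rightarrow> nat" and l :: nat and Ku :: real
  assumes "banach_space_over smul"
    and "separable_space (euclidean :: 'x topology)"
    and "infinite_dimensional_over smul"
    and "is_basis smul e es"
    and "positive_increasing n"
    and "l \<ge> 2"
    and "unconditional_cc smul e (range n) Ku"
  shows "(bounded_additive_gaps l n \<longrightarrow>
            (\<exists>C. unconditional_cc smul e {1..} C \<and>
               C \<le> max ((real (n 0) - 1) * alpha1 e * alpha2 es)
                       (Ku + Ku * real l * alpha1 e * alpha2 es + real l * alpha1 e * alpha2 es)))
       \<and> (\<forall>K. bounded_quotient_gaps l n \<and> is_schauder smul e es \<and> has_basis_constant smul e es K \<longrightarrow>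
            (\<exists>C. unconditional_cc smul e {1..} C \<and>
               C \<le> max ((real (n 0) - 1) * alpha1 e * alpha2 es)
                       ((2 * real l - 1) * Ku * K)))"
proof -
  interpret basis_over smul e es
    using assms(1,4) by (simp add: basis_over_def basis_over_axioms_def)
  have Ku: "unconditional_cc_bound smul e (range n) Ku"
    using assms(7) by (simp add: unconditional_cc_def)
  have mono: "strict_mono n" and npos: "\<And>k. 0 < n k"
    using assms(5) by (auto simp: positive_increasing_def)
  show ?thesis
  proof (intro conjI impI allI)
    assume gaps: "bounded_additive_gaps l n"
    show "\<exists>C. unconditional_cc smul e {1..} C \<and>
       C \<le> max ((real (n 0) - 1) * alpha1 e * alpha2 es)
               (Ku + Ku * real l * alpha1 e * alpha2 es + real l * alpha1 e * alpha2 es)"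
    proof (rule unconditional_cc_of_large)
      fix A and \<epsilon> \<epsilon>' :: "nat \<Rightarrow> 'f"
      assume A: "finite A" "A \<noteq> {}" and large: "n 0 \<le> card A"
        and \<epsilon>: "\<epsilon> \<in> unimodular_families A" "\<epsilon>' \<in> unimodular_families A"
      obtain k where k: "n k \<le> card A" "card A < n (Suc k)"
        using strict_mono_bracket[OF mono large] by blast
      then obtain D where D: "D \<subseteq> A" "card D = n k"
        using obtain_subset_with_card_n by metis
      have "int (n (Suc k)) - int (n k) \<le> int l"
        using gaps by (simp add: bounded_additive_gaps_def)
      moreover have "card (A - D) = card A - n k"
        using A D by (simp add: card_Diff_subset finite_subset)
      ultimately have "card (A - D) \<le> l" using k by linarith
      with D show "norm (signed_indicator smul e \<epsilon> A)
          \<le> (Ku + Ku * real l * alpha1 e * alpha2 es + real l * alpha1 e * alpha2 es)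
             * norm (signed_indicator smul e \<epsilon>' A)"
        by (intro norm_signed_indicator_additive[OF Ku A _ _ _ \<epsilon>, of D]) auto
    qed
  next
    fix K
    assume "bounded_quotient_gaps l n \<and> is_schauder smul e es \<and> has_basis_constant smul e es K"
    then have gaps: "bounded_quotient_gaps l n" and K: "partial_sum_bound smul e es K"
      by (simp_all add: has_basis_constant_def)
    show "\<exists>C. unconditional_cc smul e {1..} C \<and>
       C \<le> max ((real (n 0) - 1) * alpha1 e * alpha2 es) ((2 * real l - 1) * Ku * K)"
    proof (rule unconditional_cc_of_large)
      fix A and \<epsilon> \<epsilon>' :: "nat \<Rightarrow> 'f"
      assume A: "finite A" "A \<noteq> {}" and large: "n 0 \<le> card A"
        and \<epsilon>: "\<epsilon> \<in> unimodular_families A" "\<epsilon>' \<in> unimodular_families A"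
      obtain k where k: "n k \<le> card A" "card A < n (Suc k)"
        using strict_mono_bracket[OF mono large] by blast
      have "real (n (Suc k)) / real (n k) \<le> real l"
        using gaps by (simp add: bounded_quotient_gaps_def)
      then have "real (n (Suc k)) \<le> real (l * n k)"
        using npos[of k] by (simp add: divide_le_eq)
      then have "n (Suc k) \<le> l * n k" by (simp only: of_nat_le_iff)
      with k(2) have "card A \<le> l * n k" by simp
      then show "norm (signed_indicator smul e \<epsilon> A)
          \<le> ((2 * real l - 1) * Ku * K) * norm (signed_indicator smul e \<epsilon>' A)"
        using assms(6) by (intro norm_signed_indicator_quotient[OF Ku K A(1) _ k(1) _ _ \<epsilon>]) auto
    qed
  qed
qed

end
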